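(* Let $\Omega$ be an open set of $\mathbb{R}^d$. For any positive infinitesimal $\rho$ in ${}^*\mathbb{R}$ there exists a function $\Pi$ in ${}^*\mathcal{D}(\Omega)$ (a $\rho$-cut-off function) such that: (a) $\Pi(x)=1$ for all $x\in\widetilde\Omega$; (b) $\mathrm{supp}\,\Pi\subseteq\Omega_\rho$, where $\Omega_\rho=\{\xi\in{}^*\Omega: d(\xi,\partial\Omega)\ge\rho\}$.
   Context: Work in a nonstandard model of the complex numbers $\mathbb{C}$ with degree of saturation larger than $\mathrm{card}(\mathbb{N})$ (in particular, every countable family of internal sets with the finite intersection property has nonempty intersection). $\mathcal{D}(\Omega)=C_0^\infty(\Omega)$ (complex-valued), and ${}^*\mathcal{D}(\Omega)$, ${}^*\Omega$ denote nonstandard extensions. $\widetilde\Omega$ is the set of nearstandard points of ${}^*\Omega$: those $\xi\in{}^*\Omega$ that are finite and whose standard part belongs to $\Omega$. $\partial\Omega$ is the boundary of $\Omega$, $d(\cdot,\partial\Omega)$ is the (nonstandard extension of the) Euclidean distance to $\partial\Omega$, with $d(\xi,\emptyset)=+\infty$ if $\partial\Omega=\emptyset$; $\mathrm{supp}$ is the internal ($*$-)support. *)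

theory Defs
  imports "HOL-Analysis.Analysis"
begin

primrec Ck_on :: "(real^'n) set \<Rightarrow> (real^'n \<Rightarrow> complex) \<Rightarrow> nat \<Rightarrow> bool" where
  "Ck_on S f 0 \<longleftrightarrow> continuous_on S f"
| "Ck_on S f (Suc k) \<longleftrightarrow> (\<forall>x\<in>S. f differentiable at x) \<and>
     (\<forall>v. Ck_on S (\<lambda>x. frechet_derivative f (at x) v) k)"

definition smooth :: "(real^'n \<Rightarrow> complex) \<Rightarrow> bool" where
  "smooth f \<longleftrightarrow> (\<forall>k. Ck_on UNIV f k)"

definition supp :: "(real^'n \<Rightarrow> complex) \<Rightarrow> (real^'n) set" where
  "supp f = closure {x. f x \<noteq> 0}"

text \<open>The space \<open>C\<^sub>0\<^sup>\<infinity>(\<Omega>)\<close>; its members are extended by zero to all of \<open>\<real>\<^sup>n\<close>.\<close>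

definition test_functions :: "(real^'n) set \<Rightarrow> (real^'n \<Rightarrow> complex) set" where
  "test_functions \<Omega> = {f. smooth f \<and> compact (supp f) \<and> supp f \<subseteq> \<Omega>}"

text \<open>Unlike \<^const>\<open>infdist\<close>, this gives \<open>\<infinity>\<close> for the empty set.\<close>

definition edist_set :: "(real^'n) set \<Rightarrow> real^'n \<Rightarrow> ereal" where
  "edist_set S x = (INF y\<in>S. ereal (dist x y))"

text \<open>First-order formulas in the full language of a universe \<open>'u\<close>: every finitary relation on
  \<open>'u\<close> (a set of lists; the length of the list of variables selects the arity) is a predicate
  symbol.  Variables are natural numbers.\<close>

datatype 'u formula =
    Rel "'u list set" "nat list"
  | Eq nat nat
  | Neg "'u formula"
  | Conj "'u formula" "'u formula"
  | Ex nat "'u formula"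

primrec sat :: "('u list set \<Rightarrow> 'a list set) \<Rightarrow> (nat \<Rightarrow> 'a) \<Rightarrow> 'u formula \<Rightarrow> bool" where
  "sat I e (Rel R vs) \<longleftrightarrow> map e vs \<in> I R"
| "sat I e (Eq v w) \<longleftrightarrow> e v = e w"
| "sat I e (Neg \<phi>) \<longleftrightarrow> \<not> sat I e \<phi>"
| "sat I e (Conj \<phi> \<psi>) \<longleftrightarrow> sat I e \<phi> \<and> sat I e \<psi>"
| "sat I e (Ex v \<phi>) \<longleftrightarrow> (\<exists>a. sat I (e(v := a)) \<phi>)"

text \<open>The standard universe consists of individuals and of all sets of individuals, i.e. it is one
  step of a superstructure; the internal sets are those coded by members of the extension of the
  set of all sets.  A nonstandard model given on a full superstructure induces one in the present
  sense, by restricting the \<open>\<^sup>*\<close>-map to this universe and to the relations on it.\<close>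

datatype 'b univ = Ob 'b | Coll "'b set"

text \<open>\<open>emb\<close> is \<open>a \<mapsto> \<^sup>*a\<close> on elements and \<open>ext\<close> is \<open>R \<mapsto> \<^sup>*R\<close> on relations.\<close>

record ('u, 's) extension =
  emb :: "'u \<Rightarrow> 's"
  ext :: "'u list set \<Rightarrow> 's list set"

definition transfer_principle :: "('u, 's) extension \<Rightarrow> bool" where
  "transfer_principle M \<longleftrightarrow>
     (\<forall>\<phi> e. sat (\<lambda>R. R) e \<phi> \<longleftrightarrow> sat (ext M) (emb M \<circ> e) \<phi>)"

definition star_set :: "('u, 's) extension \<Rightarrow> 'u set \<Rightarrow> 's set" where
  "star_set M A = {\<xi>. [\<xi>] \<in> ext M ((\<lambda>a. [a]) ` A)}"

definition star_rel :: "('u, 's) extension \<Rightarrow> ('u \<Rightarrow> 'u \<Rightarrow> bool) \<Rightarrow> 's \<Rightarrow> 's \<Rightarrow> bool" where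
  "star_rel M R \<xi> \<eta> \<longleftrightarrow> [\<xi>, \<eta>] \<in> ext M {[a, b] | a b. R a b}"

text \<open>The extension of a function given by its graph, a set of lists whose last entry is the
  value.\<close>

definition star_fun :: "('u, 's) extension \<Rightarrow> 'u list set \<Rightarrow> 's list \<Rightarrow> 's" where
  "star_fun M G \<xi>s = (THE \<eta>. \<xi>s @ [\<eta>] \<in> ext M G)"

definition elem :: "'b univ \<Rightarrow> 'b univ \<Rightarrow> bool" where
  "elem a A \<longleftrightarrow> (\<exists>b B. a = Ob b \<and> A = Coll B \<and> b \<in> B)"

text \<open>The set of hyper-elements of an internal set, given by its code in \<open>\<^sup>*(range Coll)\<close>.\<close>

definition elements :: "('b univ, 's) extension \<Rightarrow> 's \<Rightarrow> 's set" where
  "elements M \<alpha> = {\<xi>. star_rel M elem \<xi> \<alpha>}"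

definition internal :: "('b univ, 's) extension \<Rightarrow> 's set \<Rightarrow> bool" where
  "internal M X \<longleftrightarrow> (\<exists>\<alpha>\<in>star_set M (range Coll). X = elements M \<alpha>)"

text \<open>Degree of saturation larger than the cardinality of the natural numbers.\<close>

definition countably_saturated :: "('b univ, 's) extension \<Rightarrow> bool" where
  "countably_saturated M \<longleftrightarrow>
     (\<forall>X :: nat \<Rightarrow> 's set. (\<forall>n. internal M (X n)) \<longrightarrow>
        (\<forall>F. finite F \<longrightarrow> (\<Inter>n\<in>F. X n) \<noteq> {}) \<longrightarrow> (\<Inter>n. X n) \<noteq> {})"

definition nonstandard_model :: "('b univ, 's) extension \<Rightarrow> bool" where
  "nonstandard_model M \<longleftrightarrow> transfer_principle M \<and> countably_saturated M"

text \<open>The extended reals are used as a sort (in place of the reals) because the distance to the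
  empty set is \<open>\<infinity>\<close>.\<close>

datatype ('n::finite) individual =
    Ext ereal
  | Cpx complex
  | Pnt "real^'n"
  | Fct "real^'n \<Rightarrow> complex"

type_synonym ('n, 's) model = "('n individual univ, 's) extension"

abbreviation ext_real :: "ereal \<Rightarrow> ('n::finite) individual univ" where "ext_real r \<equiv> Ob (Ext r)"
abbreviation real_num :: "real \<Rightarrow> ('n::finite) individual univ" where "real_num r \<equiv> Ob (Ext (ereal r))"
abbreviation cpx :: "complex \<Rightarrow> ('n::finite) individual univ" where "cpx z \<equiv> Ob (Cpx z)"
abbreviation point :: "real^'n \<Rightarrow> ('n::finite) individual univ" where "point x \<equiv> Ob (Pnt x)"
abbreviation func :: "(real^'n \<Rightarrow> complex) \<Rightarrow> ('n::finite) individual univ" where "func f \<equiv> Ob (Fct f)"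

definition star_Reals :: "('n::finite, 's) model \<Rightarrow> 's set" where
  "star_Reals M = star_set M (range real_num)"

definition star_points :: "('n::finite, 's) model \<Rightarrow> (real^'n) set \<Rightarrow> 's set" where
  "star_points M S = star_set M (point ` S)"

definition star_test_functions :: "('n::finite, 's) model \<Rightarrow> (real^'n) set \<Rightarrow> 's set" where
  "star_test_functions M \<Omega> = star_set M (func ` test_functions \<Omega>)"

definition star_le :: "('n::finite, 's) model \<Rightarrow> 's \<Rightarrow> 's \<Rightarrow> bool" where
  "star_le M = star_rel M (\<lambda>a b. \<exists>r s. a = ext_real r \<and> b = ext_real s \<and> r \<le> s)"

definition star_less :: "('n::finite, 's) model \<Rightarrow> 's \<Rightarrow> 's \<Rightarrow> bool" where
  "star_less M = star_rel M (\<lambda>a b. \<exists>r s. a = ext_real r \<and> b = ext_real s \<and> r < s)"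

definition star_abs :: "('n::finite, 's) model \<Rightarrow> 's \<Rightarrow> 's" where
  "star_abs M \<xi> = star_fun M {[real_num r, real_num \<bar>r\<bar>] | r. True} [\<xi>]"

definition star_norm :: "('n::finite, 's) model \<Rightarrow> 's \<Rightarrow> 's" where
  "star_norm M \<xi> = star_fun M {[point x, real_num (norm x)] | x. True} [\<xi>]"

definition star_dist :: "('n::finite, 's) model \<Rightarrow> 's \<Rightarrow> 's \<Rightarrow> 's" where
  "star_dist M \<xi> \<eta> = star_fun M {[point x, point y, real_num (dist x y)] | x y. True} [\<xi>, \<eta>]"

definition star_dist_set :: "('n::finite, 's) model \<Rightarrow> (real^'n) set \<Rightarrow> 's \<Rightarrow> 's" where
  "star_dist_set M S \<xi> = star_fun M {[point x, ext_real (edist_set S x)] | x. True} [\<xi>]"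

text \<open>The value of an internal function \<open>\<Phi>\<close> at \<open>\<xi>\<close> is the extension of the evaluation map
  \<open>(f, x) \<mapsto> f x\<close>.\<close>

definition star_apply :: "('n::finite, 's) model \<Rightarrow> 's \<Rightarrow> 's \<Rightarrow> 's" where
  "star_apply M \<Phi> \<xi> = star_fun M {[func f, point x, cpx (f x)] | f x. True} [\<Phi>, \<xi>]"

definition star_supp :: "('n::finite, 's) model \<Rightarrow> 's \<Rightarrow> 's set" where
  "star_supp M \<Phi> = elements M (star_fun M {[func f, Coll (Pnt ` supp f)] | f. True} [\<Phi>])"

definition infinitesimal :: "('n::finite, 's) model \<Rightarrow> 's \<Rightarrow> bool" where
  "infinitesimal M \<xi> \<longleftrightarrow> \<xi> \<in> star_Reals M \<and>
     (\<forall>\<epsilon>>0. star_less M (star_abs M \<xi>) (emb M (real_num \<epsilon>)))"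

definition finite_point :: "('n::finite, 's) model \<Rightarrow> 's \<Rightarrow> bool" where
  "finite_point M \<xi> \<longleftrightarrow> \<xi> \<in> star_points M UNIV \<and>
     (\<exists>r. star_less M (star_norm M \<xi>) (emb M (real_num r)))"

definition is_standard_part :: "('n::finite, 's) model \<Rightarrow> 's \<Rightarrow> real^'n \<Rightarrow> bool" where
  "is_standard_part M \<xi> x \<longleftrightarrow> infinitesimal M (star_dist M \<xi> (emb M (point x)))"

definition nearstandard :: "('n::finite, 's) model \<Rightarrow> (real^'n) set \<Rightarrow> 's set" where
  "nearstandard M \<Omega> =
     {\<xi> \<in> star_points M \<Omega>. finite_point M \<xi> \<and> (\<exists>x\<in>\<Omega>. is_standard_part M \<xi> x)}"

definition Omega_rho :: "('n::finite, 's) model \<Rightarrow> (real^'n) set \<Rightarrow> 's \<Rightarrow> 's set" where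
  "Omega_rho M \<Omega> \<rho> =
     {\<xi> \<in> star_points M \<Omega>. star_le M \<rho> (star_dist_set M (frontier \<Omega>) \<xi>)}"

end

theory Submission
  imports Defs
begin

text \<open>
For each real \<open>r > 0\<close> there is a classical test function \<open>F r\<close> that equals \<open>1\<close> wherever
\<open>norm x \<le> 1 / r\<close> and the ball of radius \<open>2 * r\<close> about \<open>x\<close> lies in \<open>\<Omega>\<close>, and at whose support
points the ball of radius \<open>r\<close> still lies in \<open>\<Omega>\<close> (\<open>cutoff_at_scale_exists\<close>).  The function
\<open>\<Pi>\<close> is the value at \<open>\<rho>\<close> of the extension of the map \<open>r \<mapsto> F r\<close>.  That it is an internal test
function with support in \<open>\<Omega>\<^sub>\<rho>\<close> is the transfer of statements that hold for every \<open>F r\<close>.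

The equality \<open>\<Pi> = 1\<close> at a nearstandard point cannot be transferred in one piece, since being
nearstandard is an external property.  But for a fixed standard \<open>x \<in> \<Omega>\<close> there is a standard
\<open>\<delta> > 0\<close> such that \<open>F r y = 1\<close> as soon as \<open>r < \<delta>\<close> and \<open>dist y x < \<delta>\<close>
(\<open>cutoff_at_scale_eq_1_near\<close>).  This does transfer, and both conditions hold for \<open>r = \<rho>\<close> and
every \<open>y\<close> infinitely close to \<open>x\<close>.

On the logical side, each transferred statement is an implication from finitely many atomic
statements to an atomic one, possibly under one existential quantifier;
\<open>transfer_implication_ex\<close> handles these without formulas having to be written out.
\<close>

section \<open>Closure properties of smooth functions\<close>

lemma Ck_on_SucI:
  assumes "\<And>x. (f has_derivative D x) (at x)" and "\<And>v. Ck_on UNIV (\<lambda>x. D x v) k"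
  shows "Ck_on UNIV f (Suc k)"
proof -
  have "frechet_derivative f (at x) = D x" for x
    using frechet_derivative_at[OF assms(1)] by simp
  then show ?thesis
    using assms by (auto simp: differentiable_def)
qed

lemma Ck_on_Suc_has_derivative:
  assumes "Ck_on UNIV f (Suc k)"
  shows "(f has_derivative frechet_derivative f (at x)) (at x)"
  using assms by (simp add: frechet_derivative_works)

lemma Ck_on_Suc_deriv:
  assumes "Ck_on UNIV f (Suc k)"
  shows "Ck_on UNIV (\<lambda>x. frechet_derivative f (at x) v) k"
  using assms by simp

lemma Ck_on_Suc_imp_Ck_on: "Ck_on UNIV f (Suc k) \<Longrightarrow> Ck_on UNIV f k"
proof (induction k arbitrary: f)
  case 0
  then show ?case
    by (auto intro!: continuous_at_imp_continuous_on differentiable_imp_continuous_within)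
next
  case (Suc k)
  then show ?case
    by (intro Ck_on_SucI[OF Ck_on_Suc_has_derivative[OF Suc.prems]] Suc.IH
          Ck_on_Suc_deriv[OF Suc.prems])
qed

lemma Ck_on_const: "Ck_on UNIV (\<lambda>x. c) k"
proof (induction k arbitrary: c)
  case (Suc k)
  show ?case by (rule Ck_on_SucI[where D="\<lambda>x v. 0"]) (auto intro: Suc)
qed simp

lemma Ck_on_add:
  "Ck_on UNIV f k \<Longrightarrow> Ck_on UNIV g k \<Longrightarrow> Ck_on UNIV (\<lambda>x. f x + g x) k"
proof (induction k arbitrary: f g)
  case (Suc k)
  show ?case
    by (rule Ck_on_SucI[OF has_derivative_add[OF Suc.prems[THEN Ck_on_Suc_has_derivative]]])
       (intro Suc.IH Suc.prems[THEN Ck_on_Suc_deriv])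
qed (auto intro: continuous_on_add)

lemma Ck_on_mult:
  "Ck_on UNIV f k \<Longrightarrow> Ck_on UNIV g k \<Longrightarrow> Ck_on UNIV (\<lambda>x. f x * g x) k"
proof (induction k arbitrary: f g)
  case (Suc k)
  show ?case
    by (rule Ck_on_SucI[OF has_derivative_mult[OF Suc.prems[THEN Ck_on_Suc_has_derivative]]])
       (intro Suc.IH Ck_on_add Suc.prems[THEN Ck_on_Suc_deriv] Suc.prems[THEN Ck_on_Suc_imp_Ck_on])
qed (auto intro: continuous_on_mult)

lemma Ck_on_diff:
  "Ck_on UNIV f k \<Longrightarrow> Ck_on UNIV g k \<Longrightarrow> Ck_on UNIV (\<lambda>x. f x - g x) k"
  using Ck_on_add[OF _ Ck_on_mult[OF Ck_on_const[of "-1"]], of f k g] by simp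

lemma Ck_on_inverse:
  assumes "\<And>x. f x \<noteq> 0"
  shows "Ck_on UNIV f k \<Longrightarrow> Ck_on UNIV (\<lambda>x. inverse (f x)) k"
proof (induction k)
  case 0
  then show ?case using assms by (auto intro: continuous_on_inverse)
next
  case (Suc k)
  have inv: "Ck_on UNIV (\<lambda>x. inverse (f x)) k"
    by (rule Suc.IH[OF Ck_on_Suc_imp_Ck_on[OF Suc.prems]])
  let ?D = "\<lambda>x v. (- 1) * (inverse (f x) * frechet_derivative f (at x) v * inverse (f x))"
  have "((\<lambda>x. inverse (f x)) has_derivative ?D x) (at x)" for x
    using Deriv.has_derivative_inverse[OF assms Ck_on_Suc_has_derivative[OF Suc.prems]] by simp
  then show ?case
    by (rule Ck_on_SucI) (intro Ck_on_mult Ck_on_const inv Ck_on_Suc_deriv[OF Suc.prems])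
qed

lemma Ck_on_prod:
  assumes "\<And>i. i \<in> A \<Longrightarrow> Ck_on UNIV (f i) k"
  shows "Ck_on UNIV (\<lambda>x. \<Prod>i\<in>A. f i x) k"
  using assms by (induction A rule: infinite_finite_induct) (auto intro: Ck_on_const Ck_on_mult)


section \<open>Smooth cut-off functions\<close>

text \<open>The whole family, and not only \<open>exp (- 1 / t)\<close>, is introduced because it is closed under
differentiation up to linear combinations (\<open>flat_deriv\<close>).  Smoothness is then a single induction
on the order of differentiation, for all members at once.\<close>

definition flat :: "nat \<Rightarrow> real \<Rightarrow> real" where
  "flat m t = (if t > 0 then exp (- (1 / t)) / t ^ m else 0)"

lemma flat_nonneg: "flat m t \<ge> 0"
  by (simp add: flat_def)

lemma flat_pos_iff: "flat m t > 0 \<longleftrightarrow> t > 0"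
  by (simp add: flat_def)

text \<open>The exponential series gives \<open>(1 / t) ^ (m + 2) / fact (m + 2) \<le> exp (1 / t)\<close>.  The quadratic
bound is what makes the derivative at \<open>0\<close> exist and vanish.\<close>

lemma flat_le_square: "flat m t \<le> fact (m + 2) * t\<^sup>2"
proof (cases "t > 0")
  case True
  have "(1 / t) ^ (m + 2) / fact (m + 2) \<le> exp (1 / t)"
  proof -
    have s: "(\<lambda>n. (1 / t) ^ n / fact n) sums exp (1 / t)"
      using exp_converges[of "1 / t"] by (simp add: scaleR_conv_of_real field_simps)
    show ?thesis
      using sum_le_suminf[OF sums_summable[OF s], of "{m + 2}"] True sums_unique[OF s] by simp
  qed
  then have "1 \<le> fact (m + 2) * t ^ (m + 2) * exp (1 / t)"
    using True by (simp add: power_divide pos_divide_le_eq mult_ac del: fact_Suc power_Suc add_2_eq_Suc')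
  then have "exp (- (1 / t)) \<le> fact (m + 2) * t ^ (m + 2)"
    by (simp add: exp_minus inverse_eq_divide pos_divide_le_eq del: fact_Suc power_Suc add_2_eq_Suc')
  then show ?thesis
    using True
    by (simp add: flat_def pos_divide_le_eq power_add mult_ac del: fact_Suc add_2_eq_Suc')
qed (simp add: flat_def)

lemma flat_deriv:
  "(flat m has_real_derivative flat (m + 2) t - real m * flat (m + 1) t) (at t)"
proof -
  consider "t > 0" | "t < 0" | "t = 0" by linarith
  then show ?thesis
  proof cases
    case 1
    have "((\<lambda>t. exp (- (1 / t)) / t ^ m) has_real_derivative
             flat (m + 2) t - real m * flat (m + 1) t) (at t)"
      using 1 by (auto intro!: derivative_eq_intros simp: flat_def field_simps power_add power2_eq_square)
         (cases m; simp add: field_simps)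
    then show ?thesis
      by (rule has_field_derivative_transform_within[where d=t])
         (use 1 in \<open>auto simp: flat_def dist_real_def\<close>)
  next
    case 2
    have "((\<lambda>t. 0) has_real_derivative flat (m + 2) t - real m * flat (m + 1) t) (at t)"
      using 2 by (simp add: flat_def)
    then show ?thesis
      by (rule has_field_derivative_transform_within[where d="- t"])
         (use 2 in \<open>auto simp: flat_def dist_real_def\<close>)
  next
    case 3
    have "((\<lambda>h. flat m h / h) \<longlongrightarrow> 0) (at 0)"
    proof (rule Lim_null_comparison)
      have "norm (flat m h / h) \<le> fact (m + 2) * \<bar>h\<bar>" for h
      proof (cases "h = 0")
        case False
        have "fact (m + 2) * h\<^sup>2 = fact (m + 2) * \<bar>h\<bar> * \<bar>h\<bar>"
          by (metis mult.assoc power2_abs power2_eq_square)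
        then show ?thesis
          using flat_le_square[of m h] flat_nonneg[of m h] False by (simp add: pos_divide_le_eq)
      qed simp
      then show "\<forall>\<^sub>F h in at 0. norm (flat m h / h) \<le> fact (m + 2) * \<bar>h\<bar>"
        by simp
      show "((\<lambda>h. fact (m + 2) * \<bar>h\<bar>) \<longlongrightarrow> 0) (at (0::real))"
        by (auto intro!: tendsto_eq_intros)
    qed
    then show ?thesis
      using 3 by (simp add: DERIV_def flat_def)
  qed
qed

text \<open>By the chain rule and \<open>flat_deriv\<close>, a derivative of \<open>flat m \<circ> q\<close> is a combination of
\<open>flat (m + 1) \<circ> q\<close> and \<open>flat (m + 2) \<circ> q\<close> with smooth coefficients, so the induction on the order
has to keep \<open>m\<close> arbitrary.\<close>

lemma Ck_on_flat_comp:
  fixes q :: "real^'n \<Rightarrow> real"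
  assumes q: "\<And>x. (q has_derivative Dq x) (at x)"
    and Dq: "\<And>v k. Ck_on UNIV (\<lambda>x. complex_of_real (Dq x v)) k"
  shows "Ck_on UNIV (\<lambda>x. complex_of_real (flat m (q x))) k"
proof (induction k arbitrary: m)
  case 0
  have "continuous_on UNIV (flat m)"
    by (meson DERIV_isCont flat_deriv continuous_at_imp_continuous_on)
  moreover have "continuous_on UNIV q"
    by (meson q has_derivative_continuous continuous_at_imp_continuous_on)
  ultimately show ?case
    using continuous_on_compose2[of UNIV "flat m" UNIV q] by (auto intro: continuous_on_of_real)
next
  case (Suc k)
  let ?D = "\<lambda>x v. (of_real (flat (m + 2) (q x)) - of_nat m * of_real (flat (m + 1) (q x)))
              * complex_of_real (Dq x v)"
  have "((\<lambda>x. complex_of_real (flat m (q x))) has_derivative ?D x) (at x)" for x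
    using has_derivative_of_real[OF has_derivative_compose[OF q
            flat_deriv[unfolded has_field_derivative_def]], of m x, where 'a=complex]
    by (simp add: o_def)
  then show ?case
    by (rule Ck_on_SucI) (intro Ck_on_mult Ck_on_diff Ck_on_const Suc.IH Dq)
qed

lemma Ck_on_flat_sphere:
  fixes c :: "real^'n"
  shows "Ck_on UNIV (\<lambda>x. complex_of_real (flat m (a * (dist x c)\<^sup>2 + b))) k"
proof (rule Ck_on_flat_comp)
  fix x :: "real^'n"
  have "((\<lambda>x. a * ((x - c) \<bullet> (x - c)) + b) has_derivative (\<lambda>v. 2 * a * ((x - c) \<bullet> v))) (at x)"
    by (auto intro!: derivative_eq_intros simp: inner_commute algebra_simps)
  then show "((\<lambda>x. a * (dist x c)\<^sup>2 + b) has_derivative (\<lambda>v. 2 * a * ((x - c) \<bullet> v))) (at x)"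
    by (simp add: dist_norm power2_norm_eq_inner)
next
  fix v :: "real^'n" and k
  let ?f = "\<lambda>x. complex_of_real (2 * a * ((x - c) \<bullet> v))"
  have der: "(?f has_derivative (\<lambda>w. of_real (2 * a * (w \<bullet> v)))) (at x)" for x
    by (rule has_derivative_of_real) (auto intro!: derivative_eq_intros)
  have "Ck_on UNIV ?f (Suc k)"
    by (rule Ck_on_SucI[OF der Ck_on_const])
  then show "Ck_on UNIV ?f k"
    by (rule Ck_on_Suc_imp_Ck_on)
qed

text \<open>The bump is \<open>A / (A + B)\<close> with smooth \<open>A, B \<ge> 0\<close>, where \<open>A\<close> is positive exactly inside the outer
sphere and \<open>B\<close> exactly outside the inner one.  Since \<open>s < r\<close>, the denominator never vanishes.\<close>

lemma smooth_bump_exists: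
  fixes c :: "real^'n"
  assumes "0 < s" "s < r"
  obtains f where "smooth f" "\<And>x. dist x c \<le> s \<Longrightarrow> f x = 1" "\<And>x. dist x c \<ge> r \<Longrightarrow> f x = 0"
proof -
  define A where "A x = flat 0 (- 1 * (dist x c)\<^sup>2 + r\<^sup>2)" for x
  define B where "B x = flat 0 (1 * (dist x c)\<^sup>2 + - s\<^sup>2)" for x
  define f where "f x = complex_of_real (A x) * inverse (of_real (A x) + of_real (B x))" for x
  have A: "A x > 0 \<longleftrightarrow> dist x c < r" "A x \<ge> 0" for x
    using assms by (auto simp: A_def flat_pos_iff flat_nonneg power2_less_imp_less
        intro: power_strict_mono)
  have B: "B x > 0 \<longleftrightarrow> dist x c > s" "B x \<ge> 0" for x
    using assms by (auto simp: B_def flat_pos_iff flat_nonneg power2_less_imp_less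
        intro: power_strict_mono)
  have "A x + B x > 0" for x
    using A[of x] B[of x] assms by (cases "dist x c < r") linarith+
  then have pos: "complex_of_real (A x) + of_real (B x) \<noteq> 0" for x
    by (metis of_real_add of_real_eq_0_iff less_irrefl)
  have smooth_AB: "Ck_on UNIV (\<lambda>x. complex_of_real (A x)) k"
      "Ck_on UNIV (\<lambda>x. complex_of_real (B x)) k" for k
    unfolding A_def B_def by (rule Ck_on_flat_sphere)+
  have "smooth f"
    unfolding smooth_def f_def
    by (intro allI Ck_on_mult Ck_on_inverse Ck_on_add smooth_AB pos)
  moreover have "f x = 1" if "dist x c \<le> s" for x
  proof -
    have "B x = 0" using B[of x] that by linarith
    then show ?thesis using pos[of x] by (simp add: f_def)
  qed
  moreover have "f x = 0" if "dist x c \<ge> r" for x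
  proof -
    have "A x = 0" using A[of x] that by linarith
    then show ?thesis by (simp add: f_def)
  qed
  ultimately show ?thesis by (intro that[of f]) auto
qed

text \<open>Take a finite cover of \<open>K\<close> by balls of radius \<open>r / 2\<close> and bumps \<open>b c\<close> that are \<open>1\<close> on them.  In
\<open>1 - (\<Prod>c. 1 - b c)\<close> one factor vanishes at each point of \<open>K\<close>, while all factors are \<open>1\<close> away from
the balls of radius \<open>r\<close>.\<close>

lemma smooth_cutoff_exists:
  fixes K :: "(real^'n) set"
  assumes "compact K" "r > 0"
  obtains f where "smooth f" "compact (supp f)" "supp f \<subseteq> (\<Union>c\<in>K. cball c r)"
    "\<And>x. x \<in> K \<Longrightarrow> f x = 1"
proof -
  obtain C where C: "finite C" "C \<subseteq> K" "K \<subseteq> (\<Union>c\<in>C. ball c (r / 2))"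
    using seq_compact_imp_totally_bounded
      [OF compact_imp_seq_compact[OF assms(1)], rule_format, OF half_gt_zero[OF assms(2)]]
    by auto
  have "\<forall>c :: real^'n. \<exists>f. smooth f \<and> (\<forall>x. dist x c \<le> r / 2 \<longrightarrow> f x = 1) \<and>
      (\<forall>x. dist x c \<ge> r \<longrightarrow> f x = 0)"
  proof
    fix c :: "real^'n"
    obtain f where "smooth f" "\<And>x. dist x c \<le> r / 2 \<Longrightarrow> f x = 1" "\<And>x. dist x c \<ge> r \<Longrightarrow> f x = 0"
      by (rule smooth_bump_exists[of "r / 2" r c]) (use assms in auto)
    then show "\<exists>f. smooth f \<and> (\<forall>x. dist x c \<le> r / 2 \<longrightarrow> f x = 1) \<and>
        (\<forall>x. dist x c \<ge> r \<longrightarrow> f x = 0)"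
      by (intro exI[of _ f]) simp
  qed
  from choice[OF this] obtain b :: "real^'n \<Rightarrow> real^'n \<Rightarrow> complex" where "\<forall>c. smooth (b c) \<and>
      (\<forall>x. dist x c \<le> r / 2 \<longrightarrow> b c x = 1) \<and> (\<forall>x. dist x c \<ge> r \<longrightarrow> b c x = 0)" ..
  then have b: "smooth (b c)" "dist x c \<le> r / 2 \<Longrightarrow> b c x = 1" "dist x c \<ge> r \<Longrightarrow> b c x = 0"
    for c x
    by simp_all
  define f where "f x = 1 - (\<Prod>c\<in>C. 1 - b c x)" for x
  have "smooth f"
    using b(1) unfolding smooth_def f_def
    by (intro allI Ck_on_diff Ck_on_prod Ck_on_const) auto
  moreover have supp: "supp f \<subseteq> (\<Union>c\<in>C. cball c r)"
    unfolding supp_def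
  proof (rule closure_minimal)
    show "{x. f x \<noteq> 0} \<subseteq> (\<Union>c\<in>C. cball c r)"
    proof (rule subsetI, rule ccontr)
      fix x assume x: "x \<in> {x. f x \<noteq> 0}" "x \<notin> (\<Union>c\<in>C. cball c r)"
      have "b c x = 0" if "c \<in> C" for c
      proof (rule b(3))
        show "r \<le> dist x c"
          using x(2) that by (simp add: dist_commute not_le less_imp_le)
      qed
      then show False using x(1) by (simp add: f_def)
    qed
    show "closed (\<Union>c\<in>C. cball c r)"
      using C(1) by auto
  qed
  moreover have "compact (supp f)"
  proof -
    have "compact (\<Union>c\<in>C. cball c r)"
      using C(1) by (intro compact_UN) auto
    then have "compact ((\<Union>c\<in>C. cball c r) \<inter> supp f)"
      by (rule compact_Int_closed) (simp add: supp_def)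
    then show ?thesis
      using supp by (simp add: Int_absorb1)
  qed
  moreover have "f x = 1" if x: "x \<in> K" for x
  proof -
    obtain c where "c \<in> C" "dist x c < r / 2"
      using C(3) x by (auto simp: dist_commute)
    then have "\<exists>c\<in>C. 1 - b c x = 0"
      using b(2)[of x c] by (intro bexI[of _ c]) simp_all
    then have "(\<Prod>c\<in>C. 1 - b c x) = 0"
      by (rule prod_zero[OF C(1)])
    then show ?thesis by (simp add: f_def)
  qed
  moreover have "(\<Union>c\<in>C. cball c r) \<subseteq> (\<Union>c\<in>K. cball c r)"
    using C(2) by blast
  ultimately show ?thesis
    by (intro that[of f]) auto
qed


section \<open>Cut-off functions for an open set\<close>

lemma compact_inner_region:
  fixes \<Omega> :: "(real^'n) set"
  shows "compact {x. norm x \<le> b \<and> ball x s \<subseteq> \<Omega>}"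
proof -
  have "{x. ball x s \<subseteq> \<Omega>} = - (\<Union>z\<in>- \<Omega>. ball z s)"
    by (auto simp: dist_commute subset_iff)
  then have "closed {x. ball x s \<subseteq> \<Omega>}"
    by (simp add: closed_INT closed_Compl del: Compl_eq_Compl_iff)
  then have "compact (cball 0 b \<inter> {x. ball x s \<subseteq> \<Omega>})"
    by (intro compact_Int_closed compact_cball)
  then show ?thesis
    by (simp add: cball_def Int_def)
qed

text \<open>Balls contained in \<open>\<Omega>\<close> replace the distance to the frontier here: both express the same
condition at points of \<open>\<Omega>\<close>, but the former needs no separate treatment of an empty frontier.\<close>

definition cutoff_at_scale :: "(real^'n) set \<Rightarrow> real \<Rightarrow> (real^'n \<Rightarrow> complex) \<Rightarrow> bool" where
  "cutoff_at_scale \<Omega> r f \<longleftrightarrow> f \<in> test_functions \<Omega> \<and>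
     (\<forall>x\<in>supp f. ball x r \<subseteq> \<Omega>) \<and>
     (\<forall>x. norm x \<le> 1 / r \<and> ball x (2 * r) \<subseteq> \<Omega> \<longrightarrow> f x = 1)"

text \<open>The region where the value \<open>1\<close> is prescribed is compact, and moving one of its points by at
most \<open>r\<close> leaves a ball of radius \<open>r\<close> inside \<open>\<Omega>\<close>.\<close>

lemma cutoff_at_scale_exists:
  fixes \<Omega> :: "(real^'n) set"
  assumes "r > 0"
  shows "\<exists>f. cutoff_at_scale \<Omega> r f"
proof -
  let ?K = "{x. norm x \<le> 1 / r \<and> ball x (2 * r) \<subseteq> \<Omega>}"
  obtain f :: "real^'n \<Rightarrow> complex" where f: "smooth f" "compact (supp f)"
      "supp f \<subseteq> (\<Union>c\<in>?K. cball c r)"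
      "\<And>x. x \<in> ?K \<Longrightarrow> f x = 1"
    using smooth_cutoff_exists[OF compact_inner_region[of "1 / r" "2 * r" \<Omega>] assms] by auto
  have ball: "ball x r \<subseteq> \<Omega>" if x: "x \<in> supp f" for x
  proof -
    obtain c where c: "ball c (2 * r) \<subseteq> \<Omega>" "dist c x \<le> r"
      using f(3) x by auto
    have "ball x r \<subseteq> ball c (2 * r)"
      using c(2) by (simp add: ball_subset_ball_iff dist_commute)
    then show ?thesis using c(1) by simp
  qed
  moreover have "supp f \<subseteq> \<Omega>"
    using ball centre_in_ball assms by blast
  ultimately show ?thesis
    using f by (auto simp: cutoff_at_scale_def test_functions_def)
qed

text \<open>The regions on which cut-off functions at scale \<open>r\<close> are \<open>1\<close> exhaust \<open>\<Omega>\<close> locally uniformly as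
\<open>r\<close> tends to \<open>0\<close>.  The bound \<open>\<delta>\<close> depends on \<open>x\<close> only, which makes this usable with a standard
\<open>\<delta>\<close> and an infinitesimal \<open>r\<close>.\<close>

lemma cutoff_at_scale_eq_1_near:
  fixes \<Omega> :: "(real^'n) set"
  assumes "open \<Omega>" "x \<in> \<Omega>"
  shows "\<exists>\<delta>>0. \<forall>r f y. 0 < r \<longrightarrow> r < \<delta> \<longrightarrow> cutoff_at_scale \<Omega> r f \<longrightarrow> dist y x < \<delta> \<longrightarrow> f y = 1"
proof -
  obtain \<epsilon> where \<epsilon>: "\<epsilon> > 0" "ball x \<epsilon> \<subseteq> \<Omega>"
    using assms openE by blast
  \<comment> \<open>\<open>1\<close> and \<open>1 / (norm x + 1)\<close> give \<open>norm y \<le> 1 / r\<close>; \<open>\<epsilon> / 3\<close> leaves room for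
    \<open>dist y x + 2 * r\<close>.\<close>
  define \<delta> where "\<delta> = min 1 (min (\<epsilon> / 3) (1 / (norm x + 1)))"
  have "\<delta> > 0"
    using \<epsilon>(1) by (simp add: \<delta>_def add_nonneg_pos)
  moreover have "f y = 1"
    if r: "0 < r" "r < \<delta>" and f: "cutoff_at_scale \<Omega> r f" and y: "dist y x < \<delta>" for r f y
  proof -
    have "norm y \<le> norm x + 1"
      using y norm_triangle_sub[of y x] by (simp add: \<delta>_def dist_norm)
    also have "\<dots> \<le> 1 / r"
    proof -
      have "r \<le> 1 / (norm x + 1)" using r by (simp add: \<delta>_def)
      then show ?thesis
        using r(1) by (simp add: le_divide_eq mult.commute add_nonneg_pos)
    qed
    finally have "norm y \<le> 1 / r" .
    moreover have "ball y (2 * r) \<subseteq> ball x \<epsilon>"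
    proof -
      have "dist y x + 2 * r \<le> \<epsilon>"
        using y r(2) unfolding \<delta>_def by linarith
      then show ?thesis by (simp add: ball_subset_ball_iff)
    qed
    ultimately show ?thesis
      using f \<epsilon>(2) by (auto simp: cutoff_at_scale_def)
  qed
  ultimately show ?thesis by blast
qed

text \<open>An open set is disjoint from its frontier.  For an empty frontier the distance is \<open>\<infinity>\<close>.\<close>

lemma edist_frontier_ge:
  assumes "open \<Omega>" "ball x r \<subseteq> \<Omega>"
  shows "ereal r \<le> edist_set (frontier \<Omega>) x"
  unfolding edist_set_def
proof (rule INF_greatest)
  fix y assume "y \<in> frontier \<Omega>"
  then have "y \<notin> \<Omega>"
    using assms(1) by (simp add: frontier_def interior_open)
  then have "y \<notin> ball x r"
    using assms(2) by blast
  then show "ereal r \<le> ereal (dist x y)"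
    by simp
qed


section \<open>Transfer of implications between atomic statements\<close>

text \<open>The variables \<open>0, \<dots>, n - 1\<close> are quantified, so that a formula in these variables becomes
closed and its truth in the extension does not depend on the assignment.\<close>

fun exs :: "nat \<Rightarrow> 'u formula \<Rightarrow> 'u formula" where
  "exs 0 \<phi> = \<phi>"
| "exs (Suc n) \<phi> = exs n (Ex n \<phi>)"

fun conjs :: "('u list set \<times> nat list) list \<Rightarrow> 'u formula \<Rightarrow> 'u formula" where
  "conjs [] \<phi> = \<phi>"
| "conjs ((R, vs) # ps) \<phi> = Conj (Rel R vs) (conjs ps \<phi>)"

lemma sat_exs: "sat I e (exs n \<phi>) \<longleftrightarrow> (\<exists>e'. (\<forall>i\<ge>n. e' i = e i) \<and> sat I e' \<phi>)"
proof (induction n arbitrary: \<phi>)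
  case 0
  have "e' = e" if "\<forall>i\<ge>0. e' i = e i" for e' :: "nat \<Rightarrow> 'b"
    using that by auto
  then show ?case by auto
next
  case (Suc n)
  show ?case
  proof
    assume "sat I e (exs (Suc n) \<phi>)"
    then obtain e' a where "\<forall>i\<ge>n. e' i = e i" "sat I (e'(n := a)) \<phi>"
      using Suc by auto
    then show "\<exists>e'. (\<forall>i\<ge>Suc n. e' i = e i) \<and> sat I e' \<phi>"
      by (intro exI[of _ "e'(n := a)"]) auto
  next
    assume "\<exists>e'. (\<forall>i\<ge>Suc n. e' i = e i) \<and> sat I e' \<phi>"
    then obtain e' where e': "\<forall>i\<ge>Suc n. e' i = e i" "sat I e' \<phi>"
      by blast
    have "\<forall>i\<ge>n. (e'(n := e n)) i = e i"
      using e'(1) by (auto simp: Suc_le_eq)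
    moreover have "sat I (e'(n := e n, n := e' n)) \<phi>"
      using e'(2) by simp
    ultimately show "sat I e (exs (Suc n) \<phi>)"
      unfolding exs.simps Suc by (intro exI[of _ "e'(n := e n)"]) (auto intro: exI[of _ "e' n"])
  qed
qed

lemma sat_conjs:
  "sat I e (conjs ps \<phi>) \<longleftrightarrow> (\<forall>(R, vs)\<in>set ps. map e vs \<in> I R) \<and> sat I e \<phi>"
  by (induction ps \<phi> rule: conjs.induct) auto

text \<open>The implication is encoded as the negation of one existential closure.  The transfer principle
speaks only of assignments in the range of \<open>emb\<close>; closing the formula is what allows arbitrary
hyper-elements \<open>e 0, \<dots>, e (n - 1)\<close> in the conclusion.  The variable \<open>n\<close> carries the witness.\<close>

lemma transfer_implication_ex:
  assumes tr: "transfer_principle M"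
    and vars: "\<forall>(R, vs)\<in>set ps. set vs \<subseteq> {..<n::nat}" "set ws \<subseteq> {..n}"
    and std: "\<And>e. (\<forall>(R, vs)\<in>set ps. map e vs \<in> R) \<Longrightarrow> \<exists>b. map (e(n := b)) ws \<in> S"
    and prems: "\<forall>(R, vs)\<in>set ps. map e vs \<in> ext M R"
  shows "\<exists>b. map (e(n := b)) ws \<in> ext M S"
proof (rule ccontr)
  assume no: "\<not> ?thesis"
  let ?\<phi> = "exs n (conjs ps (Neg (Ex n (Rel S ws))))"
  have "\<not> sat (\<lambda>R. R) (\<lambda>_. undefined) ?\<phi>"
    unfolding sat_exs sat_conjs using std by (simp, blast)
  then have unsat: "\<not> sat (ext M) (emb M \<circ> (\<lambda>_. undefined)) ?\<phi>"
    using tr unfolding transfer_principle_def by blast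
  \<comment> \<open>A closing quantifier only reaches assignments that agree with the given one on the
    variables from \<open>n\<close> on, so \<open>e\<close> is cut down to the variables that occur.\<close>
  define e' where "e' i = (if i < n then e i else emb M undefined)" for i
  have "\<forall>(R, vs)\<in>set ps. map e' vs \<in> ext M R"
  proof clarify
    fix R vs assume R: "(R, vs) \<in> set ps"
    then have "map e' vs = map e vs"
      using vars(1) by (fastforce simp: e'_def)
    then show "map e' vs \<in> ext M R"
      using prems R by (auto simp del: map_eq_conv)
  qed
  moreover have "map (e'(n := b)) ws = map (e(n := b)) ws" for b
    using vars(2) by (force simp: e'_def)
  then have "\<not> sat (ext M) e' (Ex n (Rel S ws))"
    using no by (simp del: map_eq_conv)
  ultimately have "sat (ext M) e' (conjs ps (Neg (Ex n (Rel S ws))))"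
    by (simp add: sat_conjs)
  then have "sat (ext M) (emb M \<circ> (\<lambda>_. undefined)) ?\<phi>"
    unfolding sat_exs by (intro exI[of _ e']) (auto simp: e'_def)
  then show False using unsat by simp
qed

corollary transfer_implication:
  assumes tr: "transfer_principle M"
    and vars: "\<forall>(R, vs)\<in>set ps. set vs \<subseteq> {..<n::nat}" "set ws \<subseteq> {..<n}"
    and std: "\<And>e. (\<forall>(R, vs)\<in>set ps. map e vs \<in> R) \<Longrightarrow> map e ws \<in> S"
    and prems: "\<forall>(R, vs)\<in>set ps. map e vs \<in> ext M R"
  shows "map e ws \<in> ext M S"
proof -
  have upd: "map (e(n := b)) ws = map e ws" for b and e :: "nat \<Rightarrow> 'c"
    using vars(2) by auto
  have upd': "map (e(n := b)) ws = map e ws" for b and e :: "nat \<Rightarrow> 'b"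
    using vars(2) by auto
  have "\<exists>b. map (e(n := b)) ws \<in> ext M S"
    by (rule transfer_implication_ex[OF tr vars(1) _ _ prems])
       (use vars(2) std in \<open>auto simp: upd upd'\<close>)
  then show ?thesis by (simp add: upd upd')
qed

text \<open>Together with singleton relations among the premises of an implication, this introduces
standard constants into it.\<close>

lemma ext_singleton:
  assumes "transfer_principle M"
  shows "[emb M a] \<in> ext M {[a]}"
proof -
  have "sat (\<lambda>R. R) (\<lambda>_. a) (Rel {[a]} [0])" by simp
  then have "sat (ext M) (emb M \<circ> (\<lambda>_. a)) (Rel {[a]} [0])"
    using assms unfolding transfer_principle_def by blast
  then show ?thesis by simp
qed

lemma ext_equality:
  assumes "transfer_principle M" "[\<xi>, \<eta>] \<in> ext M {[a, a] | a. True}"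
  shows "\<xi> = \<eta>"
proof -
  let ?\<phi> = "exs 2 (Conj (Rel {[a, a] | a. True} [0, 1]) (Neg (Eq 0 1)))"
  have "\<not> sat (\<lambda>R. R) (\<lambda>_. undefined) ?\<phi>"
    by (auto simp: sat_exs)
  then have "\<not> sat (ext M) (emb M \<circ> (\<lambda>_. undefined)) ?\<phi>"
    using assms(1) unfolding transfer_principle_def by blast
  then have *: "\<not> sat (ext M) e (Conj (Rel {[a, a] | a. True} [0, 1]) (Neg (Eq 0 1)))"
    if "\<forall>i\<ge>2. e i = emb M undefined" for e
    using that unfolding sat_exs by auto
  show ?thesis
    using *[of "\<lambda>i. if i = 0 then \<xi> else if i = 1 then \<eta> else emb M undefined"] assms(2) by auto
qed

lemma star_fun_eqI:
  assumes tr: "transfer_principle M"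
    and functional: "\<And>as b c. length as = length \<xi>s \<Longrightarrow> as @ [b] \<in> G \<Longrightarrow> as @ [c] \<in> G \<Longrightarrow> b = c"
    and graph: "\<xi>s @ [\<eta>] \<in> ext M G"
  shows "star_fun M G \<xi>s = \<eta>"
  unfolding star_fun_def
proof (rule the_equality)
  show "\<xi>s @ [\<eta>] \<in> ext M G" by (fact graph)
next
  fix \<eta>' assume graph': "\<xi>s @ [\<eta>'] \<in> ext M G"
  define k where "k = length \<xi>s"
  define e where "e i = (\<xi>s @ [\<eta>', \<eta>]) ! i" for i
  have ins: "map e [0..<k] = \<xi>s"
    by (auto simp: e_def k_def nth_append intro!: nth_equalityI)
  have "map e [k, Suc k] \<in> ext M {[a, a] | a. True}"
  proof (rule transfer_implication[OF tr,
        where ps="[(G, [0..<k] @ [k]), (G, [0..<k] @ [Suc k])]" and n="k + 2"])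
    fix e' :: "nat \<Rightarrow> 'a"
    assume "\<forall>(R, vs)\<in>set [(G, [0..<k] @ [k]), (G, [0..<k] @ [Suc k])]. map e' vs \<in> R"
    then have "e' k = e' (Suc k)"
      by (intro functional[of "map e' [0..<k]"]) (auto simp: k_def)
    then show "map e' [k, Suc k] \<in> {[a, a] | a. True}"
      by simp
  next
    show "\<forall>(R, vs)\<in>set [(G, [0..<k] @ [k]), (G, [0..<k] @ [Suc k])]. map e vs \<in> ext M R"
      using graph graph' ins by (simp add: e_def k_def nth_append)
  qed auto
  then show "\<eta>' = \<eta>"
    by (intro ext_equality[OF tr]) (simp add: e_def k_def nth_append)
qed

text \<open>Totality on \<open>D\<close> transfers, which gives some value, and functionality identifies it with the
description in \<open>star_fun\<close>.\<close>

lemma star_fun_in_graph: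
  assumes tr: "transfer_principle M"
    and functional: "\<And>as b c. length as = length \<xi>s \<Longrightarrow> as @ [b] \<in> G \<Longrightarrow> as @ [c] \<in> G \<Longrightarrow> b = c"
    and total: "\<And>as. as \<in> D \<Longrightarrow> \<exists>b. as @ [b] \<in> G"
    and dom: "\<xi>s \<in> ext M D"
  shows "\<xi>s @ [star_fun M G \<xi>s] \<in> ext M G"
proof -
  define n where "n = length \<xi>s"
  have upd: "map (e(n := b)) ([0..<n] @ [n]) = map e [0..<n] @ [b]" for e :: "nat \<Rightarrow> 'c" and b
    by simp
  have upd': "map (e(n := b)) ([0..<n] @ [n]) = map e [0..<n] @ [b]" for e :: "nat \<Rightarrow> 'b" and b
    by simp
  have ins: "map ((!) \<xi>s) [0..<n] = \<xi>s"
    by (simp add: n_def map_nth)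
  have "\<exists>b. map (((!) \<xi>s)(n := b)) ([0..<n] @ [n]) \<in> ext M G"
    by (rule transfer_implication_ex[OF tr, where ps="[(D, [0..<n])]"])
       (use dom total in \<open>auto simp: upd upd' ins simp del: map_append\<close>)
  then obtain b where b: "\<xi>s @ [b] \<in> ext M G"
    by (auto simp: upd upd' ins simp del: map_append)
  moreover have "star_fun M G \<xi>s = b"
    by (rule star_fun_eqI[OF tr _ b]) (rule functional)
  ultimately show ?thesis by simp
qed


section \<open>Extensions of the concrete relations\<close>

definition less_graph :: "('n::finite) individual univ list set" where
  "less_graph = {[ext_real r, ext_real s] | r s. r < s}"

definition le_graph :: "('n::finite) individual univ list set" where
  "le_graph = {[ext_real r, ext_real s] | r s. r \<le> s}"

definition elem_graph :: "('n::finite) individual univ list set" where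
  "elem_graph = {[a, b] | a b. elem a b}"

lemma star_less_iff: "star_less M \<xi> \<eta> \<longleftrightarrow> [\<xi>, \<eta>] \<in> ext M less_graph"
proof -
  have *: "less_graph = {[a, b] | a b. \<exists>r s. a = ext_real r \<and> b = ext_real s \<and> r < s}"
    by (auto simp: less_graph_def)
  show ?thesis unfolding star_less_def star_rel_def * by (rule refl)
qed

lemma star_le_iff: "star_le M \<xi> \<eta> \<longleftrightarrow> [\<xi>, \<eta>] \<in> ext M le_graph"
proof -
  have *: "le_graph = {[a, b] | a b. \<exists>r s. a = ext_real r \<and> b = ext_real s \<and> r \<le> s}"
    by (auto simp: le_graph_def)
  show ?thesis unfolding star_le_def star_rel_def * by (rule refl)
qed

lemma elements_iff: "\<xi> \<in> elements M \<alpha> \<longleftrightarrow> [\<xi>, \<alpha>] \<in> ext M elem_graph"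
  by (simp add: elements_def star_rel_def elem_graph_def)

definition dist_graph :: "('n::finite) individual univ list set" where
  "dist_graph = {[point x, point y, real_num (dist x y)] | x y. True}"

definition abs_graph :: "('n::finite) individual univ list set" where
  "abs_graph = {[real_num r, real_num \<bar>r\<bar>] | r. True}"

definition dist_set_graph :: "(real^'n) set \<Rightarrow> ('n::finite) individual univ list set" where
  "dist_set_graph S = {[point x, ext_real (edist_set S x)] | x. True}"

definition apply_graph :: "('n::finite) individual univ list set" where
  "apply_graph = {[func f, point x, cpx (f x)] | f x. True}"

definition supp_graph :: "('n::finite) individual univ list set" where
  "supp_graph = {[func f, Coll (Pnt ` supp f)] | f. True}"

lemma star_dist_in_graph:
  assumes tr: "transfer_principle M" and \<xi>: "\<xi> \<in> star_points M S"
  shows "[\<xi>, emb M (point x), star_dist M \<xi> (emb M (point x))] \<in> ext M dist_graph"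
proof -
  have "[\<xi>, emb M (point x)] @ [star_fun M dist_graph [\<xi>, emb M (point x)]] \<in> ext M dist_graph"
  proof (rule star_fun_in_graph[OF tr])
    have "map ((!) [\<xi>, emb M (point x)]) [0, 1] \<in> ext M {[point x, point y] | x y. True}"
      by (rule transfer_implication[OF tr,
            where ps="[((\<lambda>a. [a]) ` point ` S, [0]), ({[point x]}, [1])]" and n=2])
         (use \<xi> ext_singleton[OF tr] in \<open>auto simp: star_points_def star_set_def\<close>)
    then show "[\<xi>, emb M (point x)] \<in> ext M {[point x, point y] | x y. True}"
      by simp
  qed (auto simp: dist_graph_def Cons_eq_append_conv append_eq_Cons_conv)
  then show ?thesis by (simp add: star_dist_def dist_graph_def)
qed

lemma star_abs_in_graph:
  assumes tr: "transfer_principle M" and \<xi>: "\<xi> \<in> star_Reals M"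
  shows "[\<xi>, star_abs M \<xi>] \<in> ext M abs_graph"
proof -
  have "[\<xi>] @ [star_fun M abs_graph [\<xi>]] \<in> ext M abs_graph"
    by (rule star_fun_in_graph[OF tr, where D="(\<lambda>a. [a]) ` range real_num"])
       (use \<xi> in \<open>auto simp: abs_graph_def star_Reals_def star_set_def Cons_eq_append_conv append_eq_Cons_conv\<close>)
  then show ?thesis by (simp add: star_abs_def abs_graph_def)
qed

lemma star_dist_set_in_graph:
  assumes tr: "transfer_principle M" and \<xi>: "\<xi> \<in> star_points M T"
  shows "[\<xi>, star_dist_set M S \<xi>] \<in> ext M (dist_set_graph S)"
proof -
  have "[\<xi>] @ [star_fun M (dist_set_graph S) [\<xi>]] \<in> ext M (dist_set_graph S)"
    by (rule star_fun_in_graph[OF tr, where D="(\<lambda>a. [a]) ` point ` T"])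
       (use \<xi> in \<open>auto simp: dist_set_graph_def star_points_def star_set_def Cons_eq_append_conv append_eq_Cons_conv\<close>)
  then show ?thesis by (simp add: star_dist_set_def dist_set_graph_def)
qed

lemma star_supp_eq_elements:
  assumes tr: "transfer_principle M" and P: "P \<in> star_set M (func ` A)"
  obtains \<alpha> where "[P, \<alpha>] \<in> ext M supp_graph" "star_supp M P = elements M \<alpha>"
proof
  have "[P] @ [star_fun M supp_graph [P]] \<in> ext M supp_graph"
    by (rule star_fun_in_graph[OF tr, where D="(\<lambda>a. [a]) ` func ` A"])
       (use P in \<open>auto simp: supp_graph_def star_set_def Cons_eq_append_conv append_eq_Cons_conv\<close>)
  then show "[P, star_fun M supp_graph [P]] \<in> ext M supp_graph"
    by simp
  show "star_supp M P = elements M (star_fun M supp_graph [P])"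
    by (simp add: star_supp_def supp_graph_def)
qed

lemma star_applyI:
  assumes tr: "transfer_principle M" and "[P, \<xi>, \<eta>] \<in> ext M apply_graph"
  shows "star_apply M P \<xi> = \<eta>"
proof -
  have "star_fun M apply_graph [P, \<xi>] = \<eta>"
    by (rule star_fun_eqI[OF tr])
       (use assms(2) in \<open>auto simp: apply_graph_def Cons_eq_append_conv append_eq_Cons_conv\<close>)
  then show ?thesis by (simp add: star_apply_def apply_graph_def)
qed

lemma infinitesimal_less:
  fixes M :: "('n::finite, 's) model"
  assumes tr: "transfer_principle M" and "infinitesimal M \<xi>" "\<epsilon> > 0"
  shows "star_less M \<xi> (emb M (real_num \<epsilon>))"
proof -
  have "[\<xi>, star_abs M \<xi>] \<in> ext M abs_graph"
    using assms by (intro star_abs_in_graph) (auto simp: infinitesimal_def)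
  moreover have "[star_abs M \<xi>, emb M (real_num \<epsilon>)] \<in> ext M less_graph"
    using assms by (auto simp: infinitesimal_def star_less_iff)
  moreover have "ereal r < s" if "ereal \<bar>r\<bar> < s" for r s
    using le_less_trans[of "ereal r" "ereal \<bar>r\<bar>" s] that by simp
  ultimately have "map ((!) [\<xi>, star_abs M \<xi>, emb M (real_num \<epsilon>)]) [0, 2] \<in> ext M less_graph"
    by (intro transfer_implication[OF tr, where ps="[(abs_graph, [0, 1]), (less_graph, [1, 2])]" and n=3])
       (auto simp: abs_graph_def less_graph_def)
  then show ?thesis by (simp add: star_less_iff)
qed


section \<open>The cut-off function at an infinitesimal scale\<close>

theorem lemma3p4:
  fixes M :: "('n::finite, 's) model"
    and \<Omega> :: "(real^'n) set"
    and \<rho> :: 's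
  assumes "nonstandard_model M"
    and "open \<Omega>"
    and "\<rho> \<in> star_Reals M"
    and "infinitesimal M \<rho>"
    and "star_less M (emb M (real_num 0)) \<rho>"
  shows "\<exists>P\<in>star_test_functions M \<Omega>.
           (\<forall>\<xi>\<in>nearstandard M \<Omega>. star_apply M P \<xi> = emb M (cpx 1)) \<and>
           star_supp M P \<subseteq> Omega_rho M \<Omega> \<rho>"
proof -
  have tr: "transfer_principle M"
    using assms(1) by (simp add: nonstandard_model_def)
  \<comment> \<open>The choice of one cut-off function per scale is made in the standard world, so that its
    graph is a relation with an extension.\<close>
  obtain F :: "real \<Rightarrow> real^'n \<Rightarrow> complex" where F: "\<And>r. r > 0 \<Longrightarrow> cutoff_at_scale \<Omega> r (F r)"
    using cutoff_at_scale_exists[of _ \<Omega>] by metis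
  define G :: "'n individual univ list set" where "G = {[real_num r, func (F r)] | r. r > 0}"
  \<comment> \<open>\<open>less_graph\<close> relates extended reals; membership in the reals excludes \<open>\<infinity>\<close> as a scale.\<close>
  have "\<exists>P. map (((!) [\<rho>, emb M (real_num 0)])(2 := P)) [0, 2] \<in> ext M G"
  proof (rule transfer_implication_ex[OF tr, where ps="[((\<lambda>a. [a]) ` range real_num, [0]),
        (less_graph, [1, 0]), ({[real_num 0]}, [1])]"])
    fix e :: "nat \<Rightarrow> 'n individual univ"
    assume "\<forall>(R, vs)\<in>set [((\<lambda>a. [a]) ` range real_num, [0]), (less_graph, [1, 0]),
        ({[real_num 0]}, [1])]. map e vs \<in> R"
    then obtain r where "e 0 = real_num r" "r > 0"
      by (auto simp: less_graph_def)
    then show "\<exists>b. map (e(2 := b)) [0, 2] \<in> G"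
      by (auto simp: G_def)
  qed (use assms(3,5) ext_singleton[OF tr] in \<open>auto simp: star_Reals_def star_set_def star_less_iff\<close>)
  then obtain P where P: "[\<rho>, P] \<in> ext M G"
    by auto
  have "map ((!) [\<rho>, P]) [1] \<in> ext M ((\<lambda>a. [a]) ` func ` test_functions \<Omega>)"
    by (rule transfer_implication[OF tr, where ps="[(G, [0, 1])]" and n=2])
       (use P F in \<open>auto simp: G_def cutoff_at_scale_def\<close>)
  then have P_test: "P \<in> star_set M (func ` test_functions \<Omega>)"
    by (simp add: star_set_def)
  have "star_apply M P \<xi> = emb M (cpx 1)" if \<xi>: "\<xi> \<in> nearstandard M \<Omega>" for \<xi>
  proof -
    obtain x where x: "x \<in> \<Omega>" "infinitesimal M (star_dist M \<xi> (emb M (point x)))"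
      using \<xi> by (auto simp: nearstandard_def is_standard_part_def)
    obtain \<delta> where \<delta>: "\<delta> > 0"
        "\<And>r f y. 0 < r \<Longrightarrow> r < \<delta> \<Longrightarrow> cutoff_at_scale \<Omega> r f \<Longrightarrow> dist y x < \<delta> \<Longrightarrow> f y = 1"
      using cutoff_at_scale_eq_1_near[OF assms(2) x(1)] by blast
    let ?e = "(!) [\<rho>, P, \<xi>, emb M (point x), star_dist M \<xi> (emb M (point x)),
        emb M (real_num \<delta>), emb M (cpx 1)]"
    \<comment> \<open>For the fixed standard \<open>x\<close> and \<open>\<delta>\<close>, the fact that \<open>r < \<delta>\<close> and \<open>dist y x < \<delta>\<close> imply
      \<open>F r y = 1\<close> is transferred and applied to \<open>\<rho>\<close> and \<open>\<xi>\<close>.\<close>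
    have "map ?e [1, 2, 6] \<in> ext M apply_graph"
    proof (rule transfer_implication[OF tr, where ps="[(G, [0, 1]), (less_graph, [0, 5]),
          (dist_graph, [2, 3, 4]), (less_graph, [4, 5]), ({[point x]}, [3]),
          ({[real_num \<delta>]}, [5]), ({[cpx 1]}, [6])]" and n=7])
      fix e :: "nat \<Rightarrow> 'n individual univ"
      assume "\<forall>(R, vs)\<in>set [(G, [0, 1]), (less_graph, [0, 5]), (dist_graph, [2, 3, 4]),
          (less_graph, [4, 5]), ({[point x]}, [3]), ({[real_num \<delta>]}, [5]), ({[cpx 1]}, [6])].
          map e vs \<in> R"
      then obtain r y where "e 1 = func (F r)" "0 < r" "r < \<delta>" "e 2 = point y" "dist y x < \<delta>"
          "e 6 = cpx 1"
        by (auto simp: G_def less_graph_def dist_graph_def)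
      moreover from this have "F r y = 1"
        using \<delta>(2) F by blast
      ultimately show "map e [1, 2, 6] \<in> apply_graph"
        by (auto simp: apply_graph_def)
    next
      have "[\<xi>, emb M (point x), star_dist M \<xi> (emb M (point x))] \<in> ext M dist_graph"
        using \<xi> by (intro star_dist_in_graph[OF tr]) (auto simp: nearstandard_def)
      then show "\<forall>(R, vs)\<in>set [(G, [0, 1]), (less_graph, [0, 5]), (dist_graph, [2, 3, 4]),
          (less_graph, [4, 5]), ({[point x]}, [3]), ({[real_num \<delta>]}, [5]), ({[cpx 1]}, [6])].
          map ?e vs \<in> ext M R"
        using P ext_singleton[OF tr] infinitesimal_less[OF tr _ \<delta>(1)] assms(4) x(2)
        by (simp add: star_less_iff)
    qed auto
    then show ?thesis
      by (intro star_applyI[OF tr]) simp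
  qed
  moreover have "star_supp M P \<subseteq> Omega_rho M \<Omega> \<rho>"
  proof
    fix \<xi> assume "\<xi> \<in> star_supp M P"
    then obtain \<alpha> where \<alpha>: "[P, \<alpha>] \<in> ext M supp_graph" "[\<xi>, \<alpha>] \<in> ext M elem_graph"
      using star_supp_eq_elements[OF tr P_test] by (metis elements_iff)
    have inner: "x \<in> \<Omega> \<and> ereal r \<le> edist_set (frontier \<Omega>) x" if "r > 0" "x \<in> supp (F r)" for r x
      using F[OF that(1)] that edist_frontier_ge[OF assms(2), of x r]
      by (auto simp: cutoff_at_scale_def test_functions_def)
    have "map ((!) [\<rho>, P, \<alpha>, \<xi>]) [3] \<in> ext M ((\<lambda>a. [a]) ` point ` \<Omega>)"
      by (rule transfer_implication[OF tr,
            where ps="[(G, [0, 1]), (supp_graph, [1, 2]), (elem_graph, [3, 2])]" and n=4])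
         (use P \<alpha> inner in \<open>auto simp: G_def supp_graph_def elem_graph_def elem_def\<close>)
    then have \<xi>: "\<xi> \<in> star_points M \<Omega>"
      by (simp add: star_points_def star_set_def)
    have "map ((!) [\<rho>, P, \<alpha>, \<xi>, star_dist_set M (frontier \<Omega>) \<xi>]) [0, 4] \<in> ext M le_graph"
      by (rule transfer_implication[OF tr, where ps="[(G, [0, 1]), (supp_graph, [1, 2]),
            (elem_graph, [3, 2]), (dist_set_graph (frontier \<Omega>), [3, 4])]" and n=5])
         (use P \<alpha> inner star_dist_set_in_graph[OF tr \<xi>] in
           \<open>auto simp: G_def supp_graph_def elem_graph_def elem_def dist_set_graph_def le_graph_def\<close>)
    then show "\<xi> \<in> Omega_rho M \<Omega> \<rho>"
      using \<xi> by (simp add: Omega_rho_def star_le_iff)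
  qed
  ultimately show ?thesis
    using P_test unfolding star_test_functions_def by blast
qed

end
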